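(* Let $X$ and $Y$ be real Banach spaces and suppose that $Y$ has the Daugavet property. Let $T: X\to Y$ be a continuous linear operator whose adjoint $T': Y'\to X'$ is an isometry onto its range, and let $R: X\to Y$ be a continuous linear operator with $\|R\|=1$. Then: (1) If for every $\varepsilon>0$ there are a slice $S_0\in S_T$ and an element $y\in S_Y$ such that $R(S_0)\subset B_\varepsilon(y)$, then $\|T+R\|=2$. (2) If $S_R\le S_T$ and $R$ is weakly compact, then $\|T+R\|=2$.
   Context: All Banach spaces are real. For a Banach space $X$, $B_X$ is the closed unit ball, $S_X$ the unit sphere, $X'$ the dual space. $B_\varepsilon(y)$ denotes the closed ball with centre $y$ and radius $\varepsilon$. A Banach space $Y$ has the Daugavet property if $\|\mathrm{Id}+Q\|=1+\|Q\|$ for every rank one continuous linear operator $Q: Y\to Y$. For $x'\in X'$ with $\|x'\|=1$ and $\varepsilon>0$, the slice determined by $x'$ and $\varepsilon$ is $S(x',\varepsilon)=\{x\in B_X : \langle x,x'\rangle\ge 1-\varepsilon\}$. For a continuous linear operator $T: X\to Y$, the set of slices associated to $T$ is $$S_T=\{S(T'(y')/\|T'(y')\|,\varepsilon): 0<\varepsilon<1,\ y'\in Y',\ T'(y')\neq 0\},$$ and $S_R$ is defined in the same way for $R$ (do not confuse $S_T$, $S_R$ for operators with the unit sphere $S_Y$ of a space). One writes $S_R\le S_T$ ($R$ is slice continuous with respect to $T$) if for every slice $S\in S_R$ there is a slice $S_1\in S_T$ such that $S_1\subset S$. *)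

theory Defs
  imports "HOL-Analysis.Analysis"
begin

(* Real Banach spaces are types of class banach, 'a =>L 'b is the space of continuous
   linear operators with the operator norm, and 'a =>L real is the dual space. *)

definition dual_map ::
  "('a::real_normed_vector \<Rightarrow>\<^sub>L 'b::real_normed_vector) \<Rightarrow> ('b \<Rightarrow>\<^sub>L real) \<Rightarrow> ('a \<Rightarrow>\<^sub>L real)"
  where "dual_map T y' = y' o\<^sub>L T"

(* A dim of 1 forces a genuine one-element basis: dim is 0 for the zero space and also
   for infinite-dimensional spaces. *)
definition rank_one :: "('a::real_normed_vector \<Rightarrow>\<^sub>L 'b::real_normed_vector) \<Rightarrow> bool"
  where "rank_one Q \<longleftrightarrow> dim (range (blinfun_apply Q)) = 1"

definition daugavet_property :: "'a::banach itself \<Rightarrow> bool"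
  where "daugavet_property _ \<longleftrightarrow>
    (\<forall>Q :: 'a \<Rightarrow>\<^sub>L 'a. rank_one Q \<longrightarrow> norm (id_blinfun + Q) = 1 + norm Q)"

definition slice :: "('a::real_normed_vector \<Rightarrow>\<^sub>L real) \<Rightarrow> real \<Rightarrow> 'a set"
  where "slice x' \<epsilon> = {x \<in> cball 0 1. blinfun_apply x' x \<ge> 1 - \<epsilon>}"

definition slices_of ::
  "('a::real_normed_vector \<Rightarrow>\<^sub>L 'b::real_normed_vector) \<Rightarrow> 'a set set"
  where "slices_of T =
    {slice (dual_map T y' /\<^sub>R norm (dual_map T y')) \<epsilon> | y' \<epsilon>.
       0 < \<epsilon> \<and> \<epsilon> < 1 \<and> dual_map T y' \<noteq> 0}"

definition slice_continuous ::
  "('a::real_normed_vector \<Rightarrow>\<^sub>L 'b::real_normed_vector) \<Rightarrow> ('a \<Rightarrow>\<^sub>L 'b) \<Rightarrow> bool"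
  where "slice_continuous R T \<longleftrightarrow> (\<forall>S \<in> slices_of R. \<exists>S\<^sub>1 \<in> slices_of T. S\<^sub>1 \<subseteq> S)"

definition weak_topology :: "'a::real_normed_vector topology"
  where "weak_topology =
    topology_generated_by {blinfun_apply f -` U | (f :: 'a \<Rightarrow>\<^sub>L real) U. open U}"

(* The image of the closed unit ball is relatively compact in the weak topology. *)
definition weakly_compact_operator ::
  "('a::real_normed_vector \<Rightarrow>\<^sub>L 'b::real_normed_vector) \<Rightarrow> bool"
  where "weakly_compact_operator R \<longleftrightarrow>
    compactin weak_topology (weak_topology closure_of (blinfun_apply R ` cball 0 1))"

end

(* Testing the Daugavet equation on the operator x |-> h(x) v shows that every slice of T, given by
   h o T, contains a slice of T on which norm (v + l T x) is almost norm v + l for 0 <= l <= 1, first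
   for one vector v, then for all v in a compact set. With v = y this settles (1).

   For (2), take g in the dual of Y with norm (g o R) almost 1 and a slice S of T inside the
   corresponding slice of R; then g is almost 1 on R(S). No denting point of the closure of R(B_X)
   is needed. Instead choose points x_i of S inductively, each T x_i being almost additive in norm
   with the partial sums of the R x_j and T x_j for j < i. By weak compactness and Mazur's theorem
   some w lies in the closed convex hull of every tail of (R x_i). So there are convex
   combinations c of R x_i for i < N and c' = R p with p a convex combination of x_i for i >= N,
   both close to w, and norm (T p + R p) is almost norm (T p + c), hence almost 1 + norm c, where
   norm c >= g c is almost 1. *)
theory Submission
  imports Defs
begin

section \<open>Sublinear functionals, the Hahn-Banach theorem and separation of a convex set from
  the origin\<close>

definition sublinear :: "('a::real_vector \<Rightarrow> real) \<Rightarrow> bool"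
  where "sublinear p \<longleftrightarrow>
    (\<forall>x y. p (x + y) \<le> p x + p y) \<and> (\<forall>t\<ge>0. \<forall>x. p (t *\<^sub>R x) = t * p x)"

lemma sublinear_zero: "sublinear p \<Longrightarrow> p 0 = 0"
  unfolding sublinear_def by (metis mult_zero_left order_refl scale_zero_left)

lemma sublinear_neg_le: "sublinear p \<Longrightarrow> - p (- x) \<le> p x"
proof -
  assume p: "sublinear p"
  then have "p (x + - x) \<le> p x + p (- x)" unfolding sublinear_def by blast
  then show ?thesis using sublinear_zero[OF p] by simp
qed

text \<open>The witness is \<open>q x = (INF t\<ge>0. INF c\<in>C. p (x + t c) - t d)\<close>. With \<open>C = {a}\<close> and \<open>d = p a\<close> it
  shows that a minimal sublinear functional is odd, hence linear; with \<open>p = norm\<close> it gives the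
  separation theorem for \<open>C\<close> and \<open>0\<close>.\<close>
lemma sublinear_decrease:
  fixes p :: "'a::real_vector \<Rightarrow> real"
  assumes p: "sublinear p" and C: "convex C" "C \<noteq> {}" and d: "\<And>c. c \<in> C \<Longrightarrow> d \<le> p c"
  obtains q where "sublinear q" "q \<le> p" "\<And>c. c \<in> C \<Longrightarrow> q (- c) \<le> - d"
proof -
  have add: "p (x + y) \<le> p x + p y" for x y using p by (simp add: sublinear_def)
  have hom: "t \<ge> 0 \<Longrightarrow> p (t *\<^sub>R x) = t * p x" for t x using p by (simp add: sublinear_def)
  define A where "A x = {p (x + t *\<^sub>R c) - t * d | t c. t \<ge> 0 \<and> c \<in> C}" for x
  define q where "q x = Inf (A x)" for x
  have AI: "p (x + t *\<^sub>R c) - t * d \<in> A x" if "t \<ge> 0" "c \<in> C" for x t c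
    unfolding A_def using that by blast
  have ne: "A x \<noteq> {}" for x
    using C(2) AI[of 0 _ x] by (metis order_refl empty_iff ex_in_conv)
  \<comment> \<open>This bound makes the infimum finite: the cost \<open>t * d\<close> never exceeds
    \<open>p (t *\<^sub>R c)\<close>, and subadditivity trades that for
    \<open>p (x + t *\<^sub>R c) + p (- x)\<close>.\<close>
  have lb: "- p (- x) \<le> a" if a: "a \<in> A x" for a x
  proof -
    obtain t c where tc: "t \<ge> 0" "c \<in> C" "a = p (x + t *\<^sub>R c) - t * d"
      using a unfolding A_def by blast
    have "t * d \<le> p (t *\<^sub>R c)"
      using tc d by (simp add: hom mult_left_mono)
    also have "\<dots> \<le> p (x + t *\<^sub>R c) + p (- x)"
      using add[of "x + t *\<^sub>R c" "- x"] by simp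
    finally show ?thesis using tc by simp
  qed
  have q_le: "q x \<le> p (x + t *\<^sub>R c) - t * d" if "t \<ge> 0" "c \<in> C" for x t c
    unfolding q_def by (rule cInf_lower[OF AI[OF that]]) (auto intro!: bdd_belowI lb)
  have q_ge: "r \<le> q x" if "\<And>t c. t \<ge> 0 \<Longrightarrow> c \<in> C \<Longrightarrow> r \<le> p (x + t *\<^sub>R c) - t * d" for r x
    unfolding q_def by (rule cInf_greatest[OF ne]) (use that in \<open>auto simp: A_def\<close>)
  have q_add: "q (x + y) \<le> q x + q y" for x y
  proof -
    have "q (x + y) - (p (x + t *\<^sub>R c) - t * d) \<le> p (y + s *\<^sub>R e) - s * d"
      if t: "t \<ge> 0" "c \<in> C" and s: "s \<ge> 0" "e \<in> C" for t c s e
    proof -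
      \<comment> \<open>Convexity enters here: a sum of nonnegative multiples of two points of
        \<open>C\<close> is a multiple of a single point of \<open>C\<close>, so it is admissible in
        the infimum for \<open>x + y\<close>. If both weights vanish, any point of \<open>C\<close>
        will do.\<close>
      obtain z where z: "z \<in> C" "t *\<^sub>R c + s *\<^sub>R e = (t + s) *\<^sub>R z"
      proof (cases "t + s = 0")
        case True
        then have "t = 0" "s = 0" using t s by auto
        then show ?thesis using that[OF t(2)] by simp
      next
        case False
        then have "t + s > 0" using t s by simp
        show ?thesis
        proof (rule that)
          show "(t / (t + s)) *\<^sub>R c + (s / (t + s)) *\<^sub>R e \<in> C"
            using C(1) t s \<open>t + s > 0\<close>
            by (intro convexD) (auto simp: add_divide_distrib[symmetric])
        qed (use \<open>t + s > 0\<close> in \<open>simp add: scaleR_add_right\<close>)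
      qed
      have "q (x + y) \<le> p ((x + y) + (t + s) *\<^sub>R z) - (t + s) * d"
        using q_le z t s by simp
      also have "(x + y) + (t + s) *\<^sub>R z = (x + t *\<^sub>R c) + (y + s *\<^sub>R e)"
        using z(2) by (simp add: algebra_simps)
      also have "p \<dots> \<le> p (x + t *\<^sub>R c) + p (y + s *\<^sub>R e)" by (rule add)
      finally show ?thesis by (simp add: algebra_simps)
    qed
    then have *: "q (x + y) - (p (x + t *\<^sub>R c) - t * d) \<le> q y" if "t \<ge> 0" "c \<in> C" for t c
      using that by (intro q_ge)
    have "q (x + y) - q y \<le> p (x + t *\<^sub>R c) - t * d" if "t \<ge> 0" "c \<in> C" for t c
      using *[OF that] by simp
    then have "q (x + y) - q y \<le> q x" by (intro q_ge)
    then show ?thesis by simp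
  qed
  have q_le_p: "q x \<le> p x" for x
    using q_le[of 0 _ x] C(2) by auto
  have q_hom_le: "q (s *\<^sub>R x) \<le> s * q x" if "s > 0" for s x
  proof -
    have "q (s *\<^sub>R x) / s \<le> p (x + t *\<^sub>R c) - t * d" if "t \<ge> 0" "c \<in> C" for t c
    proof -
      have "q (s *\<^sub>R x) \<le> p (s *\<^sub>R x + (s * t) *\<^sub>R c) - (s * t) * d"
        using that \<open>s > 0\<close> by (intro q_le) auto
      also have "s *\<^sub>R x + (s * t) *\<^sub>R c = s *\<^sub>R (x + t *\<^sub>R c)"
        by (simp add: algebra_simps)
      also have "p \<dots> = s * p (x + t *\<^sub>R c)"
        using \<open>s > 0\<close> by (simp add: hom)
      finally show ?thesis using \<open>s > 0\<close> by (simp add: field_simps)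
    qed
    then have "q (s *\<^sub>R x) / s \<le> q x" by (intro q_ge)
    then show ?thesis using \<open>s > 0\<close> by (simp add: field_simps)
  qed
  have "q 0 = 0"
  proof (rule antisym)
    show "q 0 \<le> 0" using q_le_p[of 0] sublinear_zero[OF p] by simp
    show "0 \<le> q 0" using q_add[of 0 0] by simp
  qed
  have q_hom: "q (s *\<^sub>R x) = s * q x" if "s \<ge> 0" for s x
  proof (cases "s = 0")
    case True
    then show ?thesis using \<open>q 0 = 0\<close> by simp
  next
    case False
    then have "s > 0" using that by simp
    \<comment> \<open>The reverse inequality is the first one applied with the factor
      \<open>inverse s\<close>.\<close>
    have "q x \<le> inverse s * q (s *\<^sub>R x)"
      using q_hom_le[of "inverse s" "s *\<^sub>R x"] \<open>s > 0\<close> by simp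
    then have "s * q x \<le> q (s *\<^sub>R x)"
      using \<open>s > 0\<close> by (simp add: field_simps)
    then show ?thesis using q_hom_le[OF \<open>s > 0\<close>, of x] by simp
  qed
  show ?thesis
  proof
    show "sublinear q" using q_add q_hom by (simp add: sublinear_def)
    show "q \<le> p" using q_le_p by (simp add: le_fun_def)
    show "q (- c) \<le> - d" if "c \<in> C" for c
      using q_le[of 1 c "- c"] that sublinear_zero[OF p] by simp
  qed
qed

text \<open>The pointwise infimum works. Comparison with one fixed member bounds it from below, and
  subadditivity survives because two members of a chain have a common lower bound in the
  chain.\<close>

lemma sublinear_Inf_chain:
  fixes F :: "('a::real_vector \<Rightarrow> real) set"
  assumes ne: "F \<noteq> {}" and sub: "\<And>f. f \<in> F \<Longrightarrow> sublinear f"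
    and chain: "\<And>f g. f \<in> F \<Longrightarrow> g \<in> F \<Longrightarrow> f \<le> g \<or> g \<le> f"
  obtains q where "sublinear q" "\<And>f. f \<in> F \<Longrightarrow> q \<le> f"
proof -
  obtain f0 where f0: "f0 \<in> F" using ne by blast
  have lower: "- f0 (- x) \<le> f x" if "f \<in> F" for f x
  proof -
    have "f \<le> f0 \<or> f0 \<le> f" using chain that f0 by blast
    then show ?thesis
    proof
      assume "f \<le> f0"
      then have "f (- x) \<le> f0 (- x)" by (simp add: le_fun_def)
      then show ?thesis using sublinear_neg_le[OF sub[OF that], of x] by simp
    next
      assume "f0 \<le> f"
      then have "f0 x \<le> f x" by (simp add: le_fun_def)
      then show ?thesis using sublinear_neg_le[OF sub[OF f0], of x] by simp
    qed
  qed
  define q where "q x = (INF f\<in>F. f x)" for x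
  have q_le: "q x \<le> f x" if "f \<in> F" for f x
    unfolding q_def by (rule cINF_lower[OF _ that]) (auto intro!: bdd_belowI lower)
  have q_ge: "r \<le> q x" if "\<And>f. f \<in> F \<Longrightarrow> r \<le> f x" for r x
    unfolding q_def by (rule cINF_greatest[OF ne that])
  have q_add: "q (x + y) \<le> q x + q y" for x y
  proof -
    have "q (x + y) - f x \<le> g y" if "f \<in> F" "g \<in> F" for f g
    proof -
      obtain h where h: "h \<in> F" "h \<le> f" "h \<le> g" using chain[OF \<open>f \<in> F\<close> \<open>g \<in> F\<close>] \<open>f \<in> F\<close> \<open>g \<in> F\<close> by blast
      have "q (x + y) \<le> h x + h y"
        using q_le[OF h(1), of "x + y"] sub[OF h(1)] unfolding sublinear_def
        by (meson order_trans)
      also have "\<dots> \<le> f x + g y" using h by (simp add: le_fun_def add_mono)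
      finally show ?thesis by simp
    qed
    then have *: "q (x + y) - f x \<le> q y" if "f \<in> F" for f using that by (intro q_ge)
    have "q (x + y) - q y \<le> f x" if "f \<in> F" for f using *[OF that] by simp
    then have "q (x + y) - q y \<le> q x" by (intro q_ge)
    then show ?thesis by simp
  qed
  have q_hom: "q (t *\<^sub>R x) = t * q x" if "t \<ge> 0" for t x
  proof (cases "t = 0")
    case True
    have "q 0 = 0" unfolding q_def using ne by (simp add: sublinear_zero sub)
    then show ?thesis using True by simp
  next
    case False
    then have "t > 0" using that by simp
    have hom: "f (t *\<^sub>R x) = t * f x" if "f \<in> F" for f
      using sub[OF that] \<open>t > 0\<close> by (simp add: sublinear_def)
    show ?thesis
    proof (rule antisym)
      have "q (t *\<^sub>R x) / t \<le> q x"
        by (rule q_ge) (use \<open>t > 0\<close> hom q_le in \<open>fastforce simp: field_simps\<close>)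
      then show "q (t *\<^sub>R x) \<le> t * q x" using \<open>t > 0\<close> by (simp add: field_simps)
      show "t * q x \<le> q (t *\<^sub>R x)"
        by (rule q_ge) (use \<open>t > 0\<close> in \<open>simp add: mult_left_mono hom q_le\<close>)
    qed
  qed
  show ?thesis
  proof
    show "sublinear q" using q_add q_hom by (simp add: sublinear_def)
    show "q \<le> f" if "f \<in> F" for f using q_le[OF that] by (simp add: le_fun_def)
  qed
qed

text \<open>Zorn's lemma gives a minimal sublinear functional below \<open>p\<close>. Decreasing it
  along a single vector \<open>a\<close> cannot change it, which makes it odd, and an odd sublinear
  functional is linear.\<close>

lemma Hahn_Banach_sublinear:
  fixes p :: "'a::real_vector \<Rightarrow> real"
  assumes p: "sublinear p"
  obtains f where "linear f" "f \<le> p"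
proof -
  define A where "A = {q. sublinear q \<and> q \<le> p}"
  \<comment> \<open>The order is reversed, so that the maximal element supplied by Zorn's lemma is
    minimal pointwise.\<close>
  define P where "P f g \<longleftrightarrow> g \<le> f" for f g :: "'a \<Rightarrow> real"
  have po: "partial_order_on A (relation_of P A)"
    by (rule partial_order_on_relation_ofI) (auto simp: P_def)
  have "\<exists>m\<in>A. \<forall>a\<in>A. P m a \<longrightarrow> a = m"
  proof (rule predicate_Zorn[OF po])
    fix C assume C: "C \<in> Chains (relation_of P A)"
    then have CA: "C \<subseteq> A" by (auto simp: Chains_def relation_of_def)
    show "\<exists>u\<in>A. \<forall>a\<in>C. P a u"
    proof (cases "C = {}")
      case True
      then show ?thesis using p by (auto simp: A_def)
    next
      case False
      obtain q where q: "sublinear q" "\<And>f. f \<in> C \<Longrightarrow> q \<le> f"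
        by (rule sublinear_Inf_chain[OF False])
          (use C CA in \<open>auto simp: Chains_def relation_of_def P_def A_def\<close>)
      obtain f where f: "f \<in> C" using False by blast
      have "f \<le> p" using f CA by (auto simp: A_def)
      then have "q \<le> p" using q(2)[OF f] by (rule order_trans[rotated])
      then show ?thesis using q by (auto simp: A_def P_def)
    qed
  qed
  then obtain q where q: "sublinear q" "q \<le> p"
    and min: "\<And>r. sublinear r \<Longrightarrow> r \<le> q \<Longrightarrow> r = q"
    unfolding A_def P_def by (auto intro: order_trans)
  have neg: "q (- a) = - q a" for a
  proof -
    obtain r where r: "sublinear r" "r \<le> q" "r (- a) \<le> - q a"
      using sublinear_decrease[OF q(1), of "{a}" "q a"] by auto
    then have "q (- a) \<le> - q a" using min by blast
    then show ?thesis using sublinear_neg_le[OF q(1), of a] by simp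
  qed
  have q_le: "q (x + y) \<le> q x + q y" for x y using q(1) by (simp add: sublinear_def)
  have hom: "t \<ge> 0 \<Longrightarrow> q (t *\<^sub>R x) = t * q x" for t x using q(1) by (simp add: sublinear_def)
  have "linear q"
  proof (rule linearI)
    show "q (x + y) = q x + q y" for x y
      using q_le[of x y] q_le[of "x + y" "- y"] neg[of y] by simp
    show "q (t *\<^sub>R x) = t *\<^sub>R q x" for t x
    proof (cases "t \<ge> 0")
      case True
      then show ?thesis by (simp add: hom)
    next
      case False
      then show ?thesis using hom[of "- t" x] neg[of "t *\<^sub>R x"] by simp
    qed
  qed
  then show ?thesis using q(2) that by blast
qed

text \<open>A linear \<open>f\<close> below the decreased norm \<open>q\<close> is dominated by the
  norm, hence has norm at most 1, while \<open>f (- c) \<le> q (- c) \<le> - d\<close> gives the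
  separation.\<close>

lemma separating_blinfun:
  fixes C :: "'a::real_normed_vector set"
  assumes C: "convex C" "C \<noteq> {}" and d: "\<And>c. c \<in> C \<Longrightarrow> d \<le> norm c"
  obtains f :: "'a \<Rightarrow>\<^sub>L real" where "norm f \<le> 1" "\<And>c. c \<in> C \<Longrightarrow> d \<le> f c"
proof -
  have "sublinear (norm :: 'a \<Rightarrow> real)"
    by (simp add: sublinear_def norm_triangle_ineq)
  then obtain q where q: "sublinear q" "q \<le> (norm :: 'a \<Rightarrow> real)" "\<And>c. c \<in> C \<Longrightarrow> q (- c) \<le> - d"
    using sublinear_decrease[of norm C d] C d by metis
  obtain f where f: "linear f" "f \<le> q" using Hahn_Banach_sublinear[OF q(1)] .
  have le: "f x \<le> norm x" for x
    using f(2) q(2) by (meson le_funD order_trans)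
  have abs: "\<bar>f x\<bar> \<le> norm x" for x
    using le[of x] le[of "- x"] linear_neg[OF f(1), of x] by simp
  have bl: "bounded_linear f"
    using f(1) abs by (intro bounded_linear_intro[where K = 1]) (auto simp: linear_add linear_scale)
  show ?thesis
  proof
    show "norm (Blinfun f) \<le> 1"
      using abs bl by (intro norm_blinfun_bound) (auto simp: bounded_linear_Blinfun_apply)
    show "d \<le> Blinfun f c" if "c \<in> C" for c
    proof -
      have "f (- c) \<le> - d" using f(2) q(3)[OF that] by (meson le_funD order_trans)
      then show ?thesis using bl linear_neg[OF f(1), of c] by (simp add: bounded_linear_Blinfun_apply)
    qed
  qed
qed

lemma norming_blinfun:
  fixes y :: "'a::real_normed_vector"
  obtains f :: "'a \<Rightarrow>\<^sub>L real" where "norm f \<le> 1" "f y = norm y"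
proof -
  obtain f :: "'a \<Rightarrow>\<^sub>L real" where f: "norm f \<le> 1" "norm y \<le> f y"
    using separating_blinfun[of "{y}" "norm y"] by auto
  have "\<bar>f y\<bar> \<le> 1 * norm y"
    using norm_blinfun[of f y] f(1) by (metis mult_right_mono norm_ge_zero order_trans real_norm_def)
  then show ?thesis using f that by force
qed

section \<open>Mazur's theorem on weak closedness of convex sets\<close>

lemma topspace_weak_topology [simp]: "topspace weak_topology = UNIV"
proof -
  have "x \<in> topspace weak_topology" for x :: 'a
    unfolding weak_topology_def topology_generated_by_topspace
    by (rule UnionI[of "blinfun_apply 0 -` UNIV"]) auto
  then show ?thesis by blast
qed

text \<open>For \<open>y\<close> outside \<open>C\<close>, the translate of \<open>C\<close> by
  \<open>- y\<close> keeps a distance \<open>d\<close> from 0. A functional separating it from 0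
  defines a weakly open half-space that contains \<open>y\<close> and misses
  \<open>C\<close>.\<close>

lemma closedin_weak_topology_convex:
  fixes C :: "'a::real_normed_vector set"
  assumes C: "convex C" "closed C"
  shows "closedin weak_topology C"
proof -
  have "openin weak_topology (- C)"
  proof (subst openin_subopen, intro ballI)
    fix y assume y: "y \<in> - C"
    show "\<exists>V. openin weak_topology V \<and> y \<in> V \<and> V \<subseteq> - C"
    proof (cases "C = {}")
      case True
      then show ?thesis using openin_topspace[of "weak_topology :: 'a topology"] by auto
    next
      case False
      obtain d where d: "d > 0" "ball y d \<subseteq> - C"
        using C(2) y by (meson open_Compl open_contains_ball)
      have "convex ((\<lambda>c. - y + c) ` C)" using C(1) by (rule convex_translation)
      moreover have "d \<le> norm z" if "z \<in> (\<lambda>c. - y + c) ` C" for z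
      proof -
        obtain c where c: "c \<in> C" "z = - y + c" using \<open>z \<in> _\<close> by blast
        then have "c \<notin> ball y d" using d by blast
        then show ?thesis using c by (simp add: dist_norm norm_minus_commute)
      qed
      ultimately obtain f :: "'a \<Rightarrow>\<^sub>L real" where
        f: "\<And>z. z \<in> (\<lambda>c. - y + c) ` C \<Longrightarrow> d \<le> f z"
        using separating_blinfun[of "(\<lambda>c. - y + c) ` C" d] False by (metis image_is_empty)
      have "openin weak_topology (blinfun_apply f -` {..< f y + d})"
        unfolding weak_topology_def by (rule topology_generated_by_Basis) (use open_lessThan in blast)
      moreover have "blinfun_apply f -` {..< f y + d} \<subseteq> - C"
      proof (intro subsetI ComplI)
        fix c assume "c \<in> blinfun_apply f -` {..< f y + d}" "c \<in> C"
        then show False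
          using f[of "- y + c"] by (simp add: blinfun.add_right blinfun.minus_right blinfun.diff_right)
      qed
      ultimately show ?thesis using d(1) by (intro exI[of _ "blinfun_apply f -` {..< f y + d}"]) auto
    qed
  qed
  then show ?thesis by (simp add: closedin_def Compl_eq_Diff_UNIV)
qed

section \<open>Points where operators and functionals almost attain their norms\<close>

lemma blinfun_near_norm:
  fixes f :: "'a::real_normed_vector \<Rightarrow>\<^sub>L 'b::real_normed_vector"
  assumes "0 \<le> r" "r < norm f"
  obtains x where "norm x \<le> 1" "r < norm (f x)"
proof -
  have "\<exists>x. norm x \<le> 1 \<and> r < norm (f x)"
  proof (rule ccontr)
    assume "\<not> (\<exists>x. norm x \<le> 1 \<and> r < norm (f x))"
    then have le: "norm (f x) \<le> r" if "norm x \<le> 1" for x using that by force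
    have "norm (f x) \<le> r * norm x" for x
    proof (cases "x = 0")
      case False
      have "norm (f (x /\<^sub>R norm x)) \<le> r" using False by (intro le) simp
      then show ?thesis using False by (simp add: blinfun.scaleR_right field_simps)
    qed simp
    then have "norm f \<le> r" using assms(1) by (intro norm_blinfun_bound)
    then show False using assms(2) by simp
  qed
  then show ?thesis using that by blast
qed

lemma functional_near_norm:
  fixes f :: "'a::real_normed_vector \<Rightarrow>\<^sub>L real"
  assumes "0 \<le> r" "r < norm f"
  obtains x where "norm x \<le> 1" "r < f x"
proof -
  obtain x where x: "norm x \<le> 1" "r < norm (f x)" using blinfun_near_norm[OF assms] .
  then show ?thesis
    using that[of x] that[of "- x"] by (cases "f x \<ge> 0") (auto simp: blinfun.minus_right)
qed

lemma functional_le_norm: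
  fixes f :: "'a::real_normed_vector \<Rightarrow>\<^sub>L real"
  assumes "norm f \<le> 1"
  shows "f x \<le> norm x"
proof -
  have "\<bar>f x\<bar> \<le> norm f * norm x" using norm_blinfun[of f x] by simp
  also have "\<dots> \<le> 1 * norm x" using assms by (intro mult_right_mono) auto
  finally show ?thesis by simp
qed

text \<open>A functional norming \<open>T x\<close> is pulled back to one of norm at most 1, which
  bounds \<open>norm (T x)\<close> by \<open>norm x\<close>.\<close>

lemma norm_blinfun_le_of_dual_map:
  fixes T :: "'a::real_normed_vector \<Rightarrow>\<^sub>L 'b::real_normed_vector"
  assumes "\<And>y'. norm (dual_map T y') = norm y'"
  shows "norm T \<le> 1"
proof (rule norm_blinfun_bound)
  fix x
  obtain f :: "'b \<Rightarrow>\<^sub>L real" where f: "norm f \<le> 1" "f (T x) = norm (T x)"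
    using norming_blinfun .
  have "norm (T x) = dual_map T f x" using f(2) by (simp add: dual_map_def)
  also have "\<dots> \<le> norm x" using assms f(1) by (intro functional_le_norm) simp
  finally show "norm (T x) \<le> 1 * norm x" by simp
qed simp

section \<open>Slices on which the Daugavet property forces almost additive norms\<close>

text \<open>Let \<open>z\<close> almost attain the norm of the identity plus
  \<open>Q = h(.) v\<close>, and let \<open>k\<close> norm \<open>z + Q z\<close>. Then
  \<open>k z + h z * k v\<close> is almost 2, so \<open>k z\<close> and the moduli of
  \<open>h z\<close> and \<open>k v\<close> are almost 1, and \<open>h z\<close>, \<open>k v\<close>
  have the same sign. If both are negative, \<open>- k\<close> takes the place of \<open>k\<close>
  and is tested at \<open>- z\<close>.\<close>

lemma daugavet_functional:
  fixes h :: "'b::banach \<Rightarrow>\<^sub>L real"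
  assumes D: "daugavet_property TYPE('b)" and h: "norm h = 1" and v: "norm v = 1"
    and \<delta>: "0 < \<delta>" "\<delta> \<le> 1"
  obtains k :: "'b \<Rightarrow>\<^sub>L real" where "norm k \<le> 1" "1 - \<delta> \<le> k v" "2 - 2 * \<delta> \<le> norm (k + h)"
proof -
  define Q :: "'b \<Rightarrow>\<^sub>L 'b" where "Q = blinfun_scaleR_left v o\<^sub>L h"
  have Q: "Q x = h x *\<^sub>R v" for x by (simp add: Q_def)
  obtain x0 where x0: "h x0 \<noteq> 0" using h by (metis blinfun_eqI norm_zero zero_blinfun.rep_eq zero_neq_one)
  have "range (blinfun_apply Q) = span {v}"
  proof
    show "range (blinfun_apply Q) \<subseteq> span {v}" by (auto simp: Q span_singleton)
    have "c *\<^sub>R v = Q ((c / h x0) *\<^sub>R x0)" for c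
      using x0 by (simp add: Q blinfun.scaleR_right)
    then show "span {v} \<subseteq> range (blinfun_apply Q)" by (auto simp: span_singleton)
  qed
  moreover have "dim (span {v}) = card {v}"
    using v by (intro dim_eq_card) (auto simp: span_span independent_insert)
  ultimately have "rank_one Q" by (simp only: rank_one_def card_1_singleton_iff) simp
  then have "norm (id_blinfun + Q) = 1 + norm Q" using D by (simp add: daugavet_property_def)
  moreover have "norm h \<le> norm Q"
    using norm_blinfun[of Q] v by (intro norm_blinfun_bound) (simp_all add: Q)
  ultimately have "2 - \<delta> < norm (id_blinfun + Q)" using h \<delta> by simp
  then obtain z where z: "norm z \<le> 1" "2 - \<delta> < norm ((id_blinfun + Q) z)"
    using blinfun_near_norm[of "2 - \<delta>" "id_blinfun + Q"] \<delta> by auto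
  obtain k :: "'b \<Rightarrow>\<^sub>L real" where k: "norm k \<le> 1" "k (z + Q z) = norm (z + Q z)"
    using norming_blinfun .
  have sum: "2 - \<delta> < k z + h z * k v"
    using z(2) k(2) by (simp add: plus_blinfun.rep_eq blinfun.add_right Q blinfun.scaleR_right)
  have kz: "\<bar>k z\<bar> \<le> 1" and kv: "\<bar>k v\<bar> \<le> 1" and hz: "\<bar>h z\<bar> \<le> 1"
    using functional_le_norm[OF k(1), of z] functional_le_norm[OF k(1), of "- z"]
      functional_le_norm[OF k(1), of v] functional_le_norm[OF k(1), of "- v"]
      functional_le_norm[of h z] functional_le_norm[of h "- z"] h z(1) v
    by (auto simp: blinfun.minus_right)
  have prod: "1 - \<delta> < h z * k v" using sum kz by simp
  have norm_ge: "2 - 2 * \<delta> \<le> norm l" if "norm x \<le> 1" "2 - 2 * \<delta> \<le> l x" for l :: "'b \<Rightarrow>\<^sub>L real" and x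
  proof -
    have "l x \<le> norm l * norm x" using norm_blinfun[of l x] by simp
    also have "\<dots> \<le> norm l * 1" using that by (intro mult_left_mono) auto
    finally show ?thesis using that by simp
  qed
  have "h z * k v \<le> \<bar>h z\<bar> * \<bar>k v\<bar>" by (metis abs_ge_self abs_mult)
  moreover have "\<bar>h z\<bar> * \<bar>k v\<bar> \<le> 1 * \<bar>k v\<bar>" using hz by (intro mult_right_mono) auto
  moreover have "\<bar>h z\<bar> * \<bar>k v\<bar> \<le> \<bar>h z\<bar> * 1" using kv by (intro mult_left_mono) auto
  ultimately have *: "1 - \<delta> < \<bar>h z\<bar>" "1 - \<delta> < \<bar>k v\<bar>" "1 - \<delta> < k z"
    using prod sum hz by linarith+
  have "0 < h z * k v" using prod \<delta> by linarith
  then consider "0 < h z" "0 < k v" | "h z < 0" "k v < 0" by (auto simp: zero_less_mult_iff)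
  then show ?thesis
  proof cases
    case 1
    show ?thesis
    proof (rule that)
      show "2 - 2 * \<delta> \<le> norm (k + h)"
        using * 1 z(1) by (intro norm_ge[of z]) (simp_all add: plus_blinfun.rep_eq)
    qed (use k(1) * 1 in simp_all)
  next
    case 2
    show ?thesis
    proof (rule that)
      show "2 - 2 * \<delta> \<le> norm (- k + h)"
        using * 2 z(1) by (intro norm_ge[of "- z"])
          (simp_all add: plus_blinfun.rep_eq minus_blinfun.rep_eq uminus_blinfun.rep_eq blinfun.minus_right)
    qed (use k(1) * 2 in \<open>simp_all add: uminus_blinfun.rep_eq\<close>)
  qed
qed

text \<open>The functional \<open>k\<close> is almost 1 on the normalised \<open>v\<close> and, on
  the new slice, also on \<open>T x\<close>; it therefore bounds
  \<open>norm (v + l *\<^sub>R T x)\<close> from below for every \<open>l\<close> in the unit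
  interval at once.\<close>

lemma daugavet_subslice:
  fixes T :: "'a::real_normed_vector \<Rightarrow>\<^sub>L 'b::banach"
  assumes D: "daugavet_property TYPE('b)" and iso: "\<And>y'. norm (dual_map T y') = norm y'"
    and h: "norm h = 1" and "0 < \<delta>" "0 < \<epsilon>"
  obtains h1 :: "'b \<Rightarrow>\<^sub>L real" and \<delta>1 where "norm h1 = 1" "0 < \<delta>1"
    "slice (dual_map T h1) \<delta>1 \<subseteq> slice (dual_map T h) \<delta>"
    "\<And>x l. x \<in> slice (dual_map T h1) \<delta>1 \<Longrightarrow> 0 \<le> l \<Longrightarrow> l \<le> 1 \<Longrightarrow>
      norm v + l - \<epsilon> \<le> norm (v + l *\<^sub>R T x)"
proof -
  \<comment> \<open>The scale is set by the losses to come: \<open>4 * \<eta>\<close> must stay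
    below \<open>\<delta>\<close> for the inclusion of slices, and
    \<open>norm v * \<eta> + 4 * \<eta>\<close> below \<open>\<epsilon>\<close> for the norm
    estimate.\<close>
  define \<eta> where "\<eta> = min 1 (min \<delta> \<epsilon>) / (4 * (norm v + 2))"
  have \<eta>_eq: "4 * (norm v + 2) * \<eta> = min 1 (min \<delta> \<epsilon>)"
    unfolding \<eta>_def by (simp add: field_simps add_nonneg_eq_0_iff)
  have \<eta>: "0 < \<eta>"
    unfolding \<eta>_def using \<open>0 < \<delta>\<close> \<open>0 < \<epsilon>\<close> by (intro divide_pos_pos) (auto simp: add_nonneg_pos)
  have nv: "0 \<le> norm v * \<eta>" using \<eta> by simp
  have \<eta>8: "4 * (norm v * \<eta>) + 8 * \<eta> = min 1 (min \<delta> \<epsilon>)"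
    using \<eta>_eq by (simp add: algebra_simps)
  have \<eta>1: "8 * \<eta> \<le> 1" "8 * \<eta> \<le> \<delta>" "norm v * \<eta> + 4 * \<eta> \<le> \<epsilon>"
    using \<eta>8 nv \<eta> by linarith+
  obtain u :: 'b where u: "norm u = 1" "v = norm v *\<^sub>R u"
  proof (cases "v = 0")
    case False
    then show ?thesis using that[of "v /\<^sub>R norm v"] by simp
  next
    \<comment> \<open>For \<open>v = 0\<close> any unit vector can serve as \<open>u\<close>; one
      exists because \<open>h\<close> is nonzero.\<close>
    case True
    obtain x0 where "h x0 \<noteq> 0"
      using h by (metis blinfun_eqI norm_zero zero_blinfun.rep_eq zero_neq_one)
    then have "x0 \<noteq> 0" by auto
    then show ?thesis using True that[of "x0 /\<^sub>R norm x0"] by simp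
  qed
  obtain k :: "'b \<Rightarrow>\<^sub>L real" where k: "norm k \<le> 1" "1 - \<eta> \<le> k u" "2 - 2 * \<eta> \<le> norm (k + h)"
    using daugavet_functional[OF D h u(1) \<eta>] \<eta>1 \<eta> by auto
  have kh: "0 < norm (k + h)" using k(3) \<eta>1 \<eta> by linarith
  \<comment> \<open>Where \<open>k + h\<close> nearly attains its norm, which is almost \<open>2\<close>, both \<open>k\<close> and \<open>h\<close> are almost \<open>1\<close>.\<close>
  define h1 where "h1 = (k + h) /\<^sub>R norm (k + h)"
  have *: "norm x \<le> 1" "1 - 4 * \<eta> \<le> k (T x)" "1 - 4 * \<eta> \<le> h (T x)"
    if x: "x \<in> slice (dual_map T h1) \<eta>" for x
  proof -
    show n: "norm x \<le> 1" using x by (simp add: slice_def)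
    have "norm (T x) \<le> norm T * norm x" by (rule norm_blinfun)
    also have "\<dots> \<le> 1" using n norm_blinfun_le_of_dual_map[OF iso] by (intro mult_le_one) auto
    finally have nT: "norm (T x) \<le> 1" .
    have "1 - \<eta> \<le> h1 (T x)" using x by (simp add: slice_def dual_map_def)
    also have "h1 (T x) = (k (T x) + h (T x)) / norm (k + h)"
      by (simp add: h1_def scaleR_blinfun.rep_eq plus_blinfun.rep_eq divide_inverse mult.commute)
    finally have "(1 - \<eta>) * norm (k + h) \<le> k (T x) + h (T x)"
      using kh by (simp add: pos_le_divide_eq)
    moreover have "(1 - \<eta>) * (2 - 2 * \<eta>) \<le> (1 - \<eta>) * norm (k + h)"
      using k(3) \<eta>1 \<eta> by (intro mult_left_mono) auto
    moreover have "2 - 4 * \<eta> \<le> (1 - \<eta>) * (2 - 2 * \<eta>)" by (simp add: algebra_simps)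
    ultimately have "2 - 4 * \<eta> \<le> k (T x) + h (T x)" by linarith
    then show "1 - 4 * \<eta> \<le> k (T x)" "1 - 4 * \<eta> \<le> h (T x)"
      using functional_le_norm[OF k(1), of "T x"] functional_le_norm[of h "T x"] h nT by auto
  qed
  show ?thesis
  proof
    show "norm h1 = 1" using kh by (simp add: h1_def)
    show "0 < \<eta>" by (rule \<eta>)
    show "slice (dual_map T h1) \<eta> \<subseteq> slice (dual_map T h) \<delta>"
    proof
      fix x assume x: "x \<in> slice (dual_map T h1) \<eta>"
      show "x \<in> slice (dual_map T h) \<delta>"
        using *[OF x] \<eta>1 \<eta> by (simp add: slice_def dual_map_def)
    qed
    fix x :: 'a and l :: real
    assume x: "x \<in> slice (dual_map T h1) \<eta>" and l: "0 \<le> l" "l \<le> 1"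
    have "l * (1 - 4 * \<eta>) \<le> l * k (T x)" using *[OF x] l by (intro mult_left_mono) auto
    moreover have "l * (4 * \<eta>) \<le> 1 * (4 * \<eta>)" using l \<eta> by (intro mult_right_mono) auto
    moreover have "norm v * (1 - \<eta>) \<le> norm v * k u" using k(2) by (intro mult_left_mono) auto
    moreover have "k v = norm v * k u" by (subst u(2)) (simp add: blinfun.scaleR_right)
    moreover have "k v + l * k (T x) \<le> norm (v + l *\<^sub>R T x)"
      using functional_le_norm[OF k(1), of "v + l *\<^sub>R T x"]
      by (simp add: blinfun.add_right blinfun.scaleR_right)
    ultimately show "norm v + l - \<epsilon> \<le> norm (v + l *\<^sub>R T x)"
      using \<eta>1(3) by (simp add: algebra_simps)
  qed
qed

text \<open>The slices are nested, so passing to a subslice for one more vector keeps the estimates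
  for the earlier ones.\<close>

lemma daugavet_subslice_finite:
  fixes T :: "'a::real_normed_vector \<Rightarrow>\<^sub>L 'b::banach"
  assumes D: "daugavet_property TYPE('b)" and iso: "\<And>y'. norm (dual_map T y') = norm y'"
    and "finite F" and h: "norm h = 1" and "0 < \<delta>" "0 < \<epsilon>"
  shows "\<exists>h1 \<delta>1. norm h1 = 1 \<and> 0 < \<delta>1 \<and> slice (dual_map T h1) \<delta>1 \<subseteq> slice (dual_map T h) \<delta> \<and>
    (\<forall>v\<in>F. \<forall>x\<in>slice (dual_map T h1) \<delta>1. \<forall>l\<in>{0..1}. norm v + l - \<epsilon> \<le> norm (v + l *\<^sub>R T x))"
  using \<open>finite F\<close>
proof induction
  case empty
  then show ?case using h \<open>0 < \<delta>\<close> by blast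
next
  case (insert v F)
  then obtain h1 \<delta>1 where 1: "norm h1 = 1" "0 < \<delta>1"
    "slice (dual_map T h1) \<delta>1 \<subseteq> slice (dual_map T h) \<delta>"
    "\<forall>v\<in>F. \<forall>x\<in>slice (dual_map T h1) \<delta>1. \<forall>l\<in>{0..1}. norm v + l - \<epsilon> \<le> norm (v + l *\<^sub>R T x)"
    by blast
  obtain h2 \<delta>2 where 2: "norm h2 = 1" "0 < \<delta>2"
    "slice (dual_map T h2) \<delta>2 \<subseteq> slice (dual_map T h1) \<delta>1"
    "\<And>x l. x \<in> slice (dual_map T h2) \<delta>2 \<Longrightarrow> 0 \<le> l \<Longrightarrow> l \<le> 1 \<Longrightarrow>
      norm v + l - \<epsilon> \<le> norm (v + l *\<^sub>R T x)"
    using daugavet_subslice[OF D iso 1(1,2) \<open>0 < \<epsilon>\<close>, of v] by metis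
  show ?case
    using 1 2 by (intro exI[of _ h2] exI[of _ \<delta>2]) (auto 0 3)
qed

text \<open>A finite net with radius \<open>\<epsilon> / 3\<close> reduces the claim to finitely
  many vectors; moving to the net, the estimate there and moving back cost a third each.\<close>

lemma daugavet_slice_compact:
  fixes T :: "'a::real_normed_vector \<Rightarrow>\<^sub>L 'b::banach"
  assumes D: "daugavet_property TYPE('b)" and iso: "\<And>y'. norm (dual_map T y') = norm y'"
    and h: "norm h = 1" and \<delta>: "0 < \<delta>" and \<epsilon>: "0 < \<epsilon>" and V: "compact V"
  obtains x where "x \<in> slice (dual_map T h) \<delta>"
    "\<And>v l. v \<in> V \<Longrightarrow> 0 \<le> l \<Longrightarrow> l \<le> 1 \<Longrightarrow> norm v + l - \<epsilon> \<le> norm (v + l *\<^sub>R T x)"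
proof -
  have "V \<subseteq> (\<Union>c\<in>V. ball c (\<epsilon> / 3))" using \<epsilon> by auto
  then obtain F where F: "F \<subseteq> V" "finite F" "V \<subseteq> (\<Union>c\<in>F. ball c (\<epsilon> / 3))"
    by (rule compactE_image[OF V open_ball])
  obtain h1 \<delta>1 where 1: "norm h1 = 1" "0 < \<delta>1"
    "slice (dual_map T h1) \<delta>1 \<subseteq> slice (dual_map T h) \<delta>"
    "\<forall>v\<in>F. \<forall>x\<in>slice (dual_map T h1) \<delta>1. \<forall>l\<in>{0..1}. norm v + l - \<epsilon> / 3 \<le> norm (v + l *\<^sub>R T x)"
    using daugavet_subslice_finite[OF D iso F(2) h \<delta>, of "\<epsilon> / 3"] \<epsilon> by auto
  \<comment> \<open>The slice is nonempty because \<open>dual_map T h1\<close> has norm 1; the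
    maximum with 0 keeps the level nonnegative when \<open>\<delta>1 > 1\<close>.\<close>
  obtain x where x: "norm x \<le> 1" "max 0 (1 - \<delta>1) < dual_map T h1 x"
    using functional_near_norm[of "max 0 (1 - \<delta>1)" "dual_map T h1"] 1 iso by auto
  then have x1: "x \<in> slice (dual_map T h1) \<delta>1" by (simp add: slice_def)
  show ?thesis
  proof
    show "x \<in> slice (dual_map T h) \<delta>" using x1 1(3) by blast
    fix v and l :: real assume v: "v \<in> V" and l: "0 \<le> l" "l \<le> 1"
    obtain c where c: "c \<in> F" "dist c v < \<epsilon> / 3" using F(3) v by auto
    have "norm c + l - \<epsilon> / 3 \<le> norm (c + l *\<^sub>R T x)" using 1(4) c(1) x1 l by auto
    moreover have "norm (c + l *\<^sub>R T x) \<le> norm (v + l *\<^sub>R T x) + norm (c - v)"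
      using norm_triangle_ineq[of "v + l *\<^sub>R T x" "c - v"] by (simp add: algebra_simps)
    moreover have "norm v \<le> norm c + norm (c - v)"
      by (metis norm_minus_commute norm_triangle_sub)
    ultimately show "norm v + l - \<epsilon> \<le> norm (v + l *\<^sub>R T x)" using c(2) by (simp add: dist_norm)
  qed
qed

section \<open>Sequences in a slice with almost additive partial sums\<close>

text \<open>Each new point is chosen against the compact set of all partial sums so far, including
  their \<open>R\<close>-parts.\<close>
lemma daugavet_sequence:
  fixes T R :: "'a::real_normed_vector \<Rightarrow>\<^sub>L 'b::banach"
  assumes D: "daugavet_property TYPE('b)" and iso: "\<And>y'. norm (dual_map T y') = norm y'"
    and h: "norm h = 1" and \<delta>: "0 < \<delta>" and \<epsilon>: "0 < \<epsilon>"
  obtains x :: "nat \<Rightarrow> 'a" where "\<forall>i. x i \<in> slice (dual_map T h) \<delta>"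
    "\<forall>a b N M. (\<forall>i. a i \<in> {0..1}) \<and> (\<forall>i. b i \<in> {0..1}) \<and> N \<le> M \<longrightarrow>
      norm (\<Sum>i<N. a i *\<^sub>R R (x i)) + (\<Sum>i\<in>{N..<M}. b i) - \<epsilon>
      \<le> norm ((\<Sum>i<N. a i *\<^sub>R R (x i)) + (\<Sum>i\<in>{N..<M}. b i *\<^sub>R T (x i)))"
proof -
  \<comment> \<open>The tolerances halve at each step and add up to at most \<epsilon>. Compactness
    is placed inside the existential so that the choice function is total.\<close>
  have "\<exists>x. compact V \<longrightarrow> x \<in> slice (dual_map T h) \<delta> \<and>
    (\<forall>v\<in>V. \<forall>l\<in>{0..1}. norm v + l - \<epsilon> * (1/2)^Suc n \<le> norm (v + l *\<^sub>R T x))" for V and n :: nat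
  proof (cases "compact V")
    case True
    have "0 < \<epsilon> * (1/2)^Suc n" using \<epsilon> by simp
    from daugavet_slice_compact[OF D iso h \<delta> this True] show ?thesis
      by (metis atLeastAtMost_iff)
  qed simp
  then obtain f where f: "\<And>V n. compact V \<Longrightarrow> f V n \<in> slice (dual_map T h) \<delta>"
    "\<And>V n v l. compact V \<Longrightarrow> v \<in> V \<Longrightarrow> l \<in> {0..1} \<Longrightarrow>
      norm v + l - \<epsilon> * (1/2)^Suc n \<le> norm (v + l *\<^sub>R T (f V n))"
    by metis
  define nxt where "nxt V x = (\<lambda>z. fst z + fst (snd z) *\<^sub>R R x + snd (snd z) *\<^sub>R T x) `
    (V \<times> ({0..1::real} \<times> {0..1::real}))" for V x
  define V where "V = rec_nat {0} (\<lambda>n V. nxt V (f V n))"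
  define x where "x n = f (V n) n" for n
  have V0: "V 0 = {0}" and VSuc: "V (Suc n) = nxt (V n) (x n)" for n
    by (simp_all add: V_def x_def)
  have compact: "compact (V n)" for n
  proof (induction n)
    case (Suc n)
    then show ?case unfolding VSuc nxt_def
      by (intro compact_continuous_image continuous_intros compact_Times compact_Icc)
  qed (simp add: V0)
  have mem: "(\<Sum>i<n. a i *\<^sub>R R (x i) + b i *\<^sub>R T (x i)) \<in> V n"
    if "\<And>i. a i \<in> {0..1}" "\<And>i. b i \<in> {0..1}" for a b n
  proof (induction n)
    case (Suc n)
    let ?v = "\<Sum>i<n. a i *\<^sub>R R (x i) + b i *\<^sub>R T (x i)"
    show ?case unfolding VSuc nxt_def
      by (rule image_eqI[of _ _ "(?v, a n, b n)"]) (use Suc that in \<open>auto simp: algebra_simps\<close>)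
  qed (simp add: V0)
  show ?thesis
  proof (rule that[of x])
    show "\<forall>i. x i \<in> slice (dual_map T h) \<delta>"
      unfolding x_def by (intro allI f(1)[OF compact])
    show "\<forall>a b N M. (\<forall>i. a i \<in> {0..1}) \<and> (\<forall>i. b i \<in> {0..1}) \<and> N \<le> M \<longrightarrow>
      norm (\<Sum>i<N. a i *\<^sub>R R (x i)) + (\<Sum>i\<in>{N..<M}. b i) - \<epsilon>
      \<le> norm ((\<Sum>i<N. a i *\<^sub>R R (x i)) + (\<Sum>i\<in>{N..<M}. b i *\<^sub>R T (x i)))"
    proof (intro allI impI, elim conjE)
      fix a b :: "nat \<Rightarrow> real" and N M :: nat
      assume a: "\<forall>i. a i \<in> {0..1}" and b: "\<forall>i. b i \<in> {0..1}" and "N \<le> M"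
      define u where "u m = (\<Sum>i<N. a i *\<^sub>R R (x i)) + (\<Sum>i\<in>{N..<m}. b i *\<^sub>R T (x i))" for m
      have u_mem: "u m \<in> V m" if "N \<le> m" for m
      proof -
        \<comment> \<open>Cutting off the coefficients at \<open>N\<close> exhibits
          \<open>u m\<close> as one of the partial sums collected in \<open>V m\<close>.\<close>
        have "u m = (\<Sum>i<m. (if i < N then a i else 0) *\<^sub>R R (x i) + (if i < N then 0 else b i) *\<^sub>R T (x i))"
          using that
        proof (induction m rule: dec_induct)
          case base
          show ?case by (simp add: u_def)
        next
          case (step m)
          then show ?case by (simp add: u_def add.assoc)
        qed
        also have "\<dots> \<in> V m" using a b by (intro mem) auto
        finally show ?thesis .
      qed
      \<comment> \<open>The accumulated error is a partial geometric sum; starting the induction at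
        \<open>N\<close> rather than 0 only leaves slack.\<close>
      have "norm (u N) + (\<Sum>i\<in>{N..<m}. b i) - \<epsilon> * (1 - (1/2)^m) \<le> norm (u m)" if "N \<le> m" for m
        using that
      proof (induction m rule: dec_induct)
        case base
        have "(1/2::real)^N \<le> 1" by (simp add: power_le_one)
        then show ?case using \<epsilon> by simp
      next
        case (step m)
        have "norm (u m) + b m - \<epsilon> * (1/2)^Suc m \<le> norm (u m + b m *\<^sub>R T (x m))"
          unfolding x_def using u_mem[OF step(1)] b[rule_format] by (intro f(2)[OF compact])
        moreover have "u (Suc m) = u m + b m *\<^sub>R T (x m)"
          using step(1) by (simp add: u_def add.assoc)
        ultimately show ?case using step by (simp add: algebra_simps)
      qed
      from this[OF \<open>N \<le> M\<close>] have "norm (u N) + (\<Sum>i\<in>{N..<M}. b i) - \<epsilon> \<le> norm (u M)"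
        using \<epsilon> by (simp add: algebra_simps) (smt (verit) mult_nonneg_nonneg zero_le_power zero_le_divide_iff)
      then show "norm (\<Sum>i<N. a i *\<^sub>R R (x i)) + (\<Sum>i\<in>{N..<M}. b i) - \<epsilon>
        \<le> norm ((\<Sum>i<N. a i *\<^sub>R R (x i)) + (\<Sum>i\<in>{N..<M}. b i *\<^sub>R T (x i)))"
        by (simp add: u_def)
    qed
  qed
qed

section \<open>Convex combinations of tails and weak compactness\<close>

lemma convex_hull_image_atLeast:
  fixes y :: "nat \<Rightarrow> 'a::real_vector"
  assumes "p \<in> convex hull (y ` {N..})"
  obtains M \<mu> where "N \<le> M" "\<And>i. \<mu> i \<in> {0..1}" "(\<Sum>i\<in>{N..<M}. \<mu> i) = 1"
    "p = (\<Sum>i\<in>{N..<M}. \<mu> i *\<^sub>R y i)"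
proof -
  obtain S u where S: "finite S" "S \<subseteq> y ` {N..}" "\<forall>v\<in>S. 0 \<le> u v" "sum u S = 1"
    "(\<Sum>v\<in>S. u v *\<^sub>R v) = p"
    using assms unfolding convex_hull_explicit by blast
  \<comment> \<open>The sequence may repeat values, so one index is selected for each point;
    otherwise a weight would be counted several times.\<close>
  obtain I where I: "I \<subseteq> {N..}" "inj_on y I" "S = y ` I"
    using S(2) unfolding subset_image_inj by blast
  have "finite I" using S(1) I by (simp add: finite_image_iff)
  define M where "M = Suc (Max (insert N I))"
  have M: "I \<subseteq> {N..<M}" "N \<le> M"
    using I(1) \<open>finite I\<close> by (auto simp: M_def less_Suc_eq_le le_SucI)
  define \<mu> where "\<mu> i = (if i \<in> I then u (y i) else 0)" for i
  have "u v \<le> 1" if "v \<in> S" for v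
    using member_le_sum[of v S u] S that by auto
  then have 1: "\<mu> i \<in> {0..1}" for i using S(3) I(3) by (auto simp: \<mu>_def)
  have "(\<Sum>i\<in>{N..<M}. \<mu> i) = (\<Sum>i\<in>I. u (y i))"
    using M by (intro sum.mono_neutral_cong_right) (auto simp: \<mu>_def)
  also have "\<dots> = 1" using S(4) I by (simp add: sum.reindex)
  finally have 2: "(\<Sum>i\<in>{N..<M}. \<mu> i) = 1" .
  have "(\<Sum>i\<in>{N..<M}. \<mu> i *\<^sub>R y i) = (\<Sum>i\<in>I. u (y i) *\<^sub>R y i)"
    using M by (intro sum.mono_neutral_cong_right) (auto simp: \<mu>_def)
  also have "\<dots> = p" using S(5) I by (simp add: sum.reindex)
  finally show ?thesis using that[OF M(2) 1 2] by simp
qed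

text \<open>The closed convex hulls of the tails are weakly closed by Mazur's theorem. Any finitely
  many of them share a late term of the sequence, so weak compactness gives a point common to
  all.\<close>

lemma weakly_compact_operator_tail_hulls:
  fixes R :: "'a::real_normed_vector \<Rightarrow>\<^sub>L 'b::real_normed_vector"
  assumes R: "weakly_compact_operator R" and x: "\<And>i. norm (x i) \<le> 1"
  obtains w where "\<forall>N. w \<in> closure (convex hull ((\<lambda>i. R (x i)) ` {N::nat..}))"
proof -
  let ?K = "weak_topology closure_of (blinfun_apply R ` cball 0 1)"
  define C where "C N = closure (convex hull ((\<lambda>i. R (x i)) ` {N..}))" for N :: nat
  have R_C: "R (x i) \<in> C N" if "N \<le> i" for i N
    unfolding C_def using that by (intro subsetD[OF closure_subset] hull_inc) auto
  have R_K: "R (x i) \<in> ?K" for i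
    by (rule subsetD[OF closure_of_subset]) (use x in auto)
  have "?K \<inter> \<Inter>\<F> \<noteq> {}" if F: "finite \<F>" "\<F> \<subseteq> range C" for \<F>
  proof -
    obtain I where I: "finite I" "\<F> = C ` I" using F finite_subset_image by metis
    have "R (x (Max (insert 0 I))) \<in> C N" if "N \<in> I" for N
      using that I(1) by (intro R_C) simp
    then show ?thesis using R_K I(2) by blast
  qed
  moreover have "closedin weak_topology S" if "S \<in> range C" for S
    using that by (auto simp: C_def intro!: closedin_weak_topology_convex convex_closure convex_convex_hull)
  ultimately have "?K \<inter> \<Inter>(range C) \<noteq> {}"
    using R unfolding weakly_compact_operator_def compactin_fip by blast
  then show ?thesis using that unfolding C_def by blast
qed

section \<open>Lower bounds for the norm of \<open>T + R\<close> and the Daugavet equation\<close>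

text \<open>Since the adjoint preserves norms, normalising \<open>dual_map T y'\<close> amounts to
  normalising \<open>y'\<close>.\<close>

lemma slices_ofE:
  fixes T :: "'a::real_normed_vector \<Rightarrow>\<^sub>L 'b::real_normed_vector"
  assumes iso: "\<And>y'. norm (dual_map T y') = norm y'" and S: "S \<in> slices_of T"
  obtains h \<delta> where "norm h = 1" "0 < \<delta>" "S = slice (dual_map T h) \<delta>"
proof -
  obtain y' \<delta> where y': "0 < \<delta>" "dual_map T y' \<noteq> 0"
    "S = slice (dual_map T y' /\<^sub>R norm (dual_map T y')) \<delta>"
    using S unfolding slices_of_def by blast
  have n: "norm y' \<noteq> 0" using y'(2) iso[of y'] by auto
  have "dual_map T y' /\<^sub>R norm (dual_map T y') = dual_map T (y' /\<^sub>R norm y')"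
    by (rule blinfun_eqI) (simp only: dual_map_def iso[unfolded dual_map_def] scaleR_blinfun.rep_eq blinfun_apply_blinfun_compose)
  then show ?thesis using that[of "y' /\<^sub>R norm y'" \<delta>] y' n by simp
qed

text \<open>One \<epsilon> is lost in the almost additivity of \<open>y\<close> and
  \<open>T x\<close>, the other in replacing \<open>y\<close> by \<open>R x\<close>.\<close>

lemma daugavet_slice_small_image:
  fixes T R :: "'a::real_normed_vector \<Rightarrow>\<^sub>L 'b::banach"
  assumes D: "daugavet_property TYPE('b)" and iso: "\<And>y'. norm (dual_map T y') = norm y'"
    and \<epsilon>: "0 < \<epsilon>" and S: "S \<in> slices_of T" and y: "norm y = 1" and RS: "blinfun_apply R ` S \<subseteq> cball y \<epsilon>"
  shows "2 - 2 * \<epsilon> \<le> norm (T + R)"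
proof -
  obtain h \<delta> where h: "norm h = 1" "0 < \<delta>" "S = slice (dual_map T h) \<delta>"
    using slices_ofE[OF iso S] .
  obtain x where x: "x \<in> S" "norm y + 1 - \<epsilon> \<le> norm (y + 1 *\<^sub>R T x)"
    using daugavet_slice_compact[OF D iso h(1,2) \<epsilon>, of "{y}"] h(3)
    by (metis compact_sing insertI1 order_refl zero_le_one)
  have "norm (y + T x) \<le> norm ((T + R) x) + norm (y - R x)"
    using norm_triangle_ineq[of "(T + R) x" "y - R x"] by (simp add: plus_blinfun.rep_eq algebra_simps)
  moreover have "norm (y - R x) \<le> \<epsilon>" using RS x(1) by (auto simp: dist_norm)
  moreover have "norm ((T + R) x) \<le> norm (T + R) * 1"
    using norm_blinfun[of "T + R" x] x(1) h(3)
    by (elim order_trans) (auto simp: slice_def intro!: mult_left_le)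
  ultimately show ?thesis using x(2) y by simp
qed

text \<open>Of the five \<epsilon>, two come from \<open>norm c\<close>, one from almost additivity
  and two from replacing \<open>c\<close> by \<open>c' = R p\<close>.\<close>

lemma daugavet_weakly_compact:
  fixes T R :: "'a::real_normed_vector \<Rightarrow>\<^sub>L 'b::banach"
  assumes D: "daugavet_property TYPE('b)" and iso: "\<And>y'. norm (dual_map T y') = norm y'"
    and R: "norm R = 1" "weakly_compact_operator R" and SC: "slice_continuous R T"
    and \<epsilon>: "0 < \<epsilon>" "\<epsilon> < 1"
  shows "2 - 5 * \<epsilon> \<le> norm (T + R)"
proof -
  obtain x0 where x0: "norm x0 \<le> 1" "1 - \<epsilon> < norm (R x0)"
    using blinfun_near_norm[of "1 - \<epsilon>" R] R(1) \<epsilon> by auto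
  obtain g :: "'b \<Rightarrow>\<^sub>L real" where g: "norm g \<le> 1" "g (R x0) = norm (R x0)"
    using norming_blinfun .
  let ?g = "dual_map R g"
  have "norm (R x0) = ?g x0" using g(2) by (simp add: dual_map_def)
  also have "\<dots> \<le> norm ?g * norm x0" using norm_blinfun[of ?g x0] by simp
  also have "\<dots> \<le> norm ?g * 1" using x0 by (intro mult_left_mono) auto
  finally have ng: "1 - \<epsilon> < norm ?g" using x0 by simp
  then have "?g \<noteq> 0" using \<epsilon> by auto
  then have "slice (?g /\<^sub>R norm ?g) \<epsilon> \<in> slices_of R" using \<epsilon> unfolding slices_of_def by blast
  then obtain S where S: "S \<in> slices_of T" "S \<subseteq> slice (?g /\<^sub>R norm ?g) \<epsilon>"
    using SC unfolding slice_continuous_def by blast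
  obtain h \<delta> where h: "norm h = 1" "0 < \<delta>" "S = slice (dual_map T h) \<delta>"
    using slices_ofE[OF iso S(1)] .
  \<comment> \<open>The slice is defined by the normalised functional, whose norm before scaling
    exceeds \<open>1 - \<epsilon>\<close>; undoing the scaling gives the square of
    \<open>1 - \<epsilon>\<close>.\<close>
  have gR: "1 - 2 * \<epsilon> \<le> g (R x)" if "x \<in> S" for x
  proof -
    have "1 - \<epsilon> \<le> g (R x) / norm ?g"
      using subsetD[OF S(2) that] by (simp add: slice_def dual_map_def scaleR_blinfun.rep_eq divide_inverse mult.commute)
    moreover have "0 < norm ?g" using ng \<epsilon> by linarith
    ultimately have "(1 - \<epsilon>) * norm ?g \<le> g (R x)" by (simp only: pos_le_divide_eq)
    moreover have "(1 - \<epsilon>) * (1 - \<epsilon>) \<le> (1 - \<epsilon>) * norm ?g"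
      using ng \<epsilon> by (intro mult_left_mono) auto
    moreover have "1 - 2 * \<epsilon> \<le> (1 - \<epsilon>) * (1 - \<epsilon>)" by (simp add: algebra_simps)
    ultimately show ?thesis by linarith
  qed
  obtain x :: "nat \<Rightarrow> 'a" where x': "\<forall>i. x i \<in> slice (dual_map T h) \<delta>" and
    add: "\<forall>a b N M. (\<forall>i. a i \<in> {0..1}) \<and> (\<forall>i. b i \<in> {0..1}) \<and> N \<le> M \<longrightarrow>
      norm (\<Sum>i<N. a i *\<^sub>R R (x i)) + (\<Sum>i\<in>{N..<M}. b i) - \<epsilon>
      \<le> norm ((\<Sum>i<N. a i *\<^sub>R R (x i)) + (\<Sum>i\<in>{N..<M}. b i *\<^sub>R T (x i)))"
    using daugavet_sequence[OF D iso h(1,2) \<epsilon>(1), of R] .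
  have x: "x i \<in> S" for i using x' h(3) by blast
  have nx: "norm (x i) \<le> 1" for i using x[of i] h(3) by (simp add: slice_def)
  obtain w where w: "\<forall>N. w \<in> closure (convex hull ((\<lambda>i. R (x i)) ` {N..}))"
    using weakly_compact_operator_tail_hulls[OF R(2), of x, OF nx] .
  obtain c where c: "c \<in> convex hull ((\<lambda>i. R (x i)) ` {0..})" "dist c w < \<epsilon>"
    using w[rule_format, of 0] \<epsilon>(1) unfolding closure_approachable by blast
  obtain N a where a: "\<And>i. a i \<in> {0..1}" "(\<Sum>i\<in>{0..<N}. a i) = 1"
    "c = (\<Sum>i\<in>{0..<N}. a i *\<^sub>R R (x i))"
    using convex_hull_image_atLeast[OF c(1)] by metis
  \<comment> \<open>The second approximation of \<open>w\<close> uses indices from \<open>N\<close>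
    on, after all those in \<open>c\<close>, as the almost additivity requires.\<close>
  obtain c' where c': "c' \<in> convex hull ((\<lambda>i. R (x i)) ` {N..})" "dist c' w < \<epsilon>"
    using w[rule_format, of N] \<epsilon>(1) unfolding closure_approachable by blast
  obtain M b where b: "N \<le> M" "\<And>i. b i \<in> {0..1}" "(\<Sum>i\<in>{N..<M}. b i) = 1"
    "c' = (\<Sum>i\<in>{N..<M}. b i *\<^sub>R R (x i))"
    using convex_hull_image_atLeast[OF c'(1)] by metis
  define p where "p = (\<Sum>i\<in>{N..<M}. b i *\<^sub>R x i)"
  have Rp: "R p = c'" and Tp: "T p = (\<Sum>i\<in>{N..<M}. b i *\<^sub>R T (x i))"
    by (simp_all add: p_def b(4) blinfun.sum_right blinfun.scaleR_right)
  have "norm p \<le> (\<Sum>i\<in>{N..<M}. b i * 1)"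
    unfolding p_def using b(2) nx by (intro sum_norm_le) (simp add: mult_left_le)
  then have np: "norm p \<le> 1" using b(3) by simp
  \<comment> \<open>The lower bound for \<open>g\<close> on the image of the slice passes to convex
    combinations, which keeps \<open>c\<close> from being small.\<close>
  have "(1 - 2 * \<epsilon>) * (\<Sum>i\<in>{0..<N}. a i) \<le> (\<Sum>i\<in>{0..<N}. a i * g (R (x i)))"
    unfolding sum_distrib_left using a(1) gR[OF x]
    by (intro sum_mono) (metis atLeastAtMost_iff mult.commute mult_left_mono)
  also have "\<dots> = g c" by (simp add: a(3) blinfun.sum_right blinfun.scaleR_right)
  also have "\<dots> \<le> norm c" using g(1) by (rule functional_le_norm)
  finally have nc: "1 - 2 * \<epsilon> \<le> norm c" using a(2) by simp
  have "norm c + 1 - \<epsilon> \<le> norm (c + T p)"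
    using add[rule_format, of a b N M] a b Tp by (simp add: lessThan_atLeast0)
  moreover have "norm (c + T p) \<le> norm ((T + R) p) + norm (c - c')"
    using norm_triangle_ineq[of "(T + R) p" "c - c'"] by (simp add: plus_blinfun.rep_eq Rp algebra_simps)
  moreover have "norm (c - c') < 2 * \<epsilon>"
    using dist_triangle_less_add[OF c(2) c'(2)] by (simp add: dist_norm)
  moreover have "norm ((T + R) p) \<le> norm (T + R) * 1"
    using norm_blinfun[of "T + R" p] np by (elim order_trans) (auto intro!: mult_left_le)
  ultimately show ?thesis using nc by simp
qed

theorem theorem2p7:
  fixes T R :: "'a::banach \<Rightarrow>\<^sub>L 'b::banach"
  assumes "daugavet_property TYPE('b)"
    and "\<forall>y' z'. dist (dual_map T y') (dual_map T z') = dist y' z'"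
    and "norm R = 1"
  shows "((\<forall>\<epsilon>>0. \<exists>S\<^sub>0 \<in> slices_of T. \<exists>y \<in> sphere 0 1.
              blinfun_apply R ` S\<^sub>0 \<subseteq> cball y \<epsilon>) \<longrightarrow> norm (T + R) = 2)
       \<and> (slice_continuous R T \<and> weakly_compact_operator R \<longrightarrow> norm (T + R) = 2)"
proof -
  have "dual_map T 0 = 0" by (simp add: dual_map_def)
  then have iso: "norm (dual_map T y') = norm y'" for y'
    using assms(2)[rule_format, of y' 0] by (simp add: dist_norm)
  have le: "norm (T + R) \<le> 2"
    using norm_triangle_ineq[of T R] norm_blinfun_le_of_dual_map[OF iso] assms(3) by simp
  have ge: "norm (T + R) = 2" if *: "\<And>\<epsilon>. 0 < \<epsilon> \<Longrightarrow> \<epsilon> < 1 \<Longrightarrow> 2 - 5 * \<epsilon> \<le> norm (T + R)"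
  proof -
    have "2 \<le> norm (T + R) + e" if "0 < e" for e
      \<comment> \<open>The bound \<open>1 / 2\<close> keeps the argument below 1, and
        \<open>e / 5\<close> absorbs the factor 5.\<close>
      using *[of "min (e / 5) (1 / 2)"] that by linarith
    then show ?thesis using le by (meson antisym field_le_epsilon)
  qed
  have 1: "2 - 5 * \<epsilon> \<le> norm (T + R)"
    if small: "\<forall>\<epsilon>>0. \<exists>S\<^sub>0 \<in> slices_of T. \<exists>y \<in> sphere 0 1. blinfun_apply R ` S\<^sub>0 \<subseteq> cball y \<epsilon>"
      and \<epsilon>: "0 < \<epsilon>" for \<epsilon>
  proof -
    obtain S y where "S \<in> slices_of T" "norm y = 1" "blinfun_apply R ` S \<subseteq> cball y \<epsilon>"
      using small[rule_format, OF \<epsilon>] by auto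
    from daugavet_slice_small_image[OF assms(1) iso \<epsilon> this] show ?thesis using \<epsilon> by simp
  qed
  show ?thesis
    using 1 ge daugavet_weakly_compact[OF assms(1) iso assms(3)] by blast
qed

end
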